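(* Let $H$ be a real Hilbert space, let $P$ be an orthogonal projector in $H$ with null-space $\mathbf N$ and range $\mathbf P=\mathbf N^\perp$, let $P^\perp=I-P$, and let $A:H\to H$ be a bounded linear operator with $A=A^*\ge 0$. For $f,g\in H$ consider the problem of finding $\sigma\in H$ such that $$P^\perp(A\sigma-g)=0,\qquad P(\sigma-f)=0 .$$ Suppose that for some fixed $g\in H$ and $f\in H$ there exists a solution $\sigma$. Then it is unique provided that $\mathbf N(A)\cap\mathbf N=\{0\}$; otherwise, the set of all solutions is the hyperplane $\sigma+(\mathbf N(A)\cap\mathbf N)$, and there exists a unique normal solution (solution with minimal norm in $H$), which can also be defined as the common element of this hyperplane and the closed subspace $\overline{\mathbf R(A)+\mathbf P}$. The closed subspace $\overline{\mathbf R(A)+\mathbf P}$ is the set of all normal solutions for all possible $f$ and $g$.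
   Context: $\mathbf R(A)$ and $\mathbf N(A)$ denote the range and the null-space of $A$; the symbol $\mathbf N$ without argument is the null-space of $P$. "Hyperplane" means a translate (coset) of a closed linear subspace. "All possible $f$ and $g$" means all pairs $(f,g)\in H\times H$ for which a solution exists. *)

theory Defs
  imports "HOL-Analysis.Analysis"
begin

text \<open>Real Hilbert spaces are the types of class \<open>{real_inner, complete_space}\<close>.\<close>

definition null_space :: "('a::real_vector \<Rightarrow> 'b::real_vector) \<Rightarrow> 'a set"
  where "null_space T = {x. T x = 0}"

definition is_orthogonal_projector :: "('a::{real_inner, complete_space} \<Rightarrow> 'a) \<Rightarrow> bool"
  where "is_orthogonal_projector P \<longleftrightarrow>
    linear P \<and> P \<circ> P = P \<and> range P = orthogonal_comp (null_space P)"

text \<open>For a bounded operator \<open>A\<close>, the condition \<open>A = A\<^sup>*\<close> says that \<open>A\<close> may be moved from one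
  argument of the inner product to the other.\<close>

definition is_selfadjoint_nonneg :: "('a::{real_inner, complete_space} \<Rightarrow> 'a) \<Rightarrow> bool"
  where "is_selfadjoint_nonneg A \<longleftrightarrow>
    bounded_linear A \<and> (\<forall>x y. inner (A x) y = inner x (A y)) \<and> (\<forall>x. 0 \<le> inner (A x) x)"

definition is_hyperplane :: "'a::real_normed_vector set \<Rightarrow> bool"
  where "is_hyperplane S \<longleftrightarrow> (\<exists>a L. subspace L \<and> closed L \<and> S = (+) a ` L)"

definition complementary_projector :: "('a::real_vector \<Rightarrow> 'a) \<Rightarrow> 'a \<Rightarrow> 'a"
  where "complementary_projector P x = x - P x"

definition is_solution ::
    "('a::{real_inner, complete_space} \<Rightarrow> 'a) \<Rightarrow> ('a \<Rightarrow> 'a) \<Rightarrow> 'a \<Rightarrow> 'a \<Rightarrow> 'a \<Rightarrow> bool"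
  where "is_solution P A f g \<sigma> \<longleftrightarrow>
    complementary_projector P (A \<sigma> - g) = 0 \<and> P (\<sigma> - f) = 0"

definition is_normal_solution ::
    "('a::{real_inner, complete_space} \<Rightarrow> 'a) \<Rightarrow> ('a \<Rightarrow> 'a) \<Rightarrow> 'a \<Rightarrow> 'a \<Rightarrow> 'a \<Rightarrow> bool"
  where "is_normal_solution P A f g = is_arg_min norm (is_solution P A f g)"

end

theory Submission
  imports Defs
begin

text \<open>
  Put \<open>M = N(A) \<inter> N(P)\<close>. The statement rests on two identifications.

  First, the solutions for fixed data form a coset of \<open>M\<close>. The difference \<open>\<delta>\<close> of two solutions
  satisfies \<open>P \<delta> = 0\<close> and \<open>A \<delta> = P (A \<delta>)\<close>, so \<open>A \<delta>\<close> lies in the range of \<open>P\<close> while \<open>\<delta>\<close> lies in its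
  null space. Hence \<open>\<langle>A \<delta>, \<delta>\<rangle> = 0\<close>, and for a nonnegative self-adjoint \<open>A\<close> this forces \<open>A \<delta> = 0\<close>
  (\<open>selfadjoint_nonneg_kernel\<close>).

  Second, \<open>closure (R(A) + R(P))\<close> is the orthogonal complement of \<open>M\<close>: both operators are symmetric,
  so the range of each has its null space as orthogonal complement, which gives
  \<open>(R(A) + R(P))\<^sup>\<bottom> = M\<close> (\<open>orthogonal_comp_sum_ranges\<close>), and the projection theorem
  (\<open>orthogonal_decomposition\<close>) shows that \<open>U\<^sup>\<bottom>\<^sup>\<bottom>\<close> is the closure of \<open>U\<close> for every subspace \<open>U\<close>.

  Everything else is Pythagoras. Splitting a solution along \<open>M\<^sup>\<bottom>\<close> and \<open>M\<close> shows that the coset of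
  solutions meets \<open>M\<^sup>\<bottom>\<close>; the meeting point is the unique element of least norm in the coset
  (\<open>is_arg_min_norm_coset\<close>), and the only element of the coset in \<open>M\<^sup>\<bottom>\<close>. Conversely
  each \<open>\<tau>\<close> in \<open>M\<^sup>\<bottom>\<close> is a solution for the data \<open>f = \<tau>\<close>, \<open>g = A \<tau>\<close>, and is normal for the same reason.
\<close>

section \<open>Orthogonal complements in Hilbert spaces\<close>

text \<open>Near-minimisers of the distance form a decreasing sequence of closed sets. Their diameters
  shrink by the parallelogram law, since the midpoint of two of them is in the set too and so is no
  closer than the infimum; completeness then provides a common point.\<close>

lemma closest_point_exists_complete:
  fixes W :: "'a::{real_inner, complete_space} set"
  assumes "closed W" "convex W" "W \<noteq> {}"
  obtains w where "w \<in> W" "\<forall>z\<in>W. dist x w \<le> dist x z"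
proof -
  define d where "d = infdist x W"
  define S where "S n = {y \<in> W. (dist x y)\<^sup>2 \<le> d\<^sup>2 + 1 / real (Suc n)}" for n
  have d_le: "d \<le> dist x y" if "y \<in> W" for y
    using that by (simp add: d_def infdist_le)
  have d_nonneg: "0 \<le> d"
    by (simp add: d_def infdist_nonneg)
  have "closed (S n)" for n
  proof -
    have "S n = W \<inter> {y. (dist x y)\<^sup>2 \<le> d\<^sup>2 + 1 / real (Suc n)}"
      by (auto simp: S_def)
    then show ?thesis
      using assms(1) by (auto intro!: closed_Int closed_Collect_le continuous_intros)
  qed
  moreover have "S n \<noteq> {}" for n
  proof -
    have "d < sqrt (d\<^sup>2 + 1 / real (Suc n))"
      by (rule real_less_rsqrt) simp
    then obtain y where y: "y \<in> W" "dist x y < sqrt (d\<^sup>2 + 1 / real (Suc n))"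
      using assms(3) by (auto simp: d_def infdist_notempty cINF_less_iff)
    then have "(dist x y)\<^sup>2 \<le> (sqrt (d\<^sup>2 + 1 / real (Suc n)))\<^sup>2"
      by (intro power_mono) auto
    also have "\<dots> = d\<^sup>2 + 1 / real (Suc n)"
      by (rule real_sqrt_pow2) simp
    finally show ?thesis
      using y(1) by (auto simp: S_def)
  qed
  moreover have "S n \<subseteq> S m" if "m \<le> n" for m n
  proof -
    have "1 / real (Suc n) \<le> 1 / real (Suc m)"
      using that by (simp add: frac_le)
    then show ?thesis
      by (auto simp: S_def)
  qed
  moreover have "\<exists>n. \<forall>y\<in>S n. \<forall>z\<in>S n. dist y z < e" if "e > 0" for e
  proof -
    obtain n where n: "1 / real (Suc n) < e\<^sup>2 / 4"
      using nat_approx_posE[of "e\<^sup>2 / 4"] \<open>e > 0\<close> by auto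
    have "dist y z < e" if y: "y \<in> S n" and z: "z \<in> S n" for y z
    proof -
      define m where "m = (1/2) *\<^sub>R y + (1/2) *\<^sub>R z"
      have "m \<in> W"
        using y z convexD[OF assms(2), of y z "1/2" "1/2"] by (simp add: S_def m_def)
      then have "d\<^sup>2 \<le> (dist x m)\<^sup>2"
        by (intro power_mono d_le d_nonneg)
      moreover have "(dist y z)\<^sup>2 = 2 * (dist x y)\<^sup>2 + 2 * (dist x z)\<^sup>2 - 4 * (dist x m)\<^sup>2"
        by (simp add: dist_norm power2_norm_eq_inner m_def algebra_simps inner_commute)
      ultimately have "(dist y z)\<^sup>2 < e\<^sup>2"
        using y z n by (simp add: S_def)
      then show ?thesis
        using \<open>e > 0\<close> by (simp add: power_less_imp_less_base)
    qed
    then show ?thesis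
      by blast
  qed
  ultimately obtain w where w: "\<And>n. w \<in> S n"
    using decreasing_closed_nest[of S] by metis
  have "(dist x w)\<^sup>2 \<le> d\<^sup>2"
  proof (rule field_le_epsilon)
    fix e :: real assume "e > 0"
    then obtain n where "1 / real (Suc n) < e"
      using nat_approx_posE by blast
    then show "(dist x w)\<^sup>2 \<le> d\<^sup>2 + e"
      using w[of n] by (simp add: S_def)
  qed
  then have "dist x w \<le> d"
    using d_nonneg by (rule power2_le_imp_le)
  then show thesis
    using that[of w] w[of 0] d_le by (force simp: S_def)
qed

text \<open>The summand in \<open>W\<close> is the closest point \<open>w\<close>. Moving from \<open>w\<close> by \<open>y\<close> and by \<open>- y\<close> bounds
  \<open>\<langle>x - w, y\<rangle>\<close> from both sides.\<close>

lemma orthogonal_decomposition: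
  fixes W :: "'a::{real_inner, complete_space} set"
  assumes "closed W" "subspace W"
  obtains w u where "x = w + u" "w \<in> W" "u \<in> W\<^sup>\<bottom>"
proof -
  have conv: "convex W" and ne: "W \<noteq> {}"
    using assms(2) subspace_0 by (auto simp: subspace_imp_convex)
  obtain w where w: "w \<in> W" "\<forall>z\<in>W. dist x w \<le> dist x z"
    by (rule closest_point_exists_complete[OF assms(1) conv ne])
  have "inner y (x - w) = 0" if "y \<in> W" for y
  proof -
    have "inner (x - w) ((w + y) - w) \<le> 0" "inner (x - w) ((w - y) - w) \<le> 0"
      using w that assms(2)
      by (intro any_closest_point_dot[OF conv assms(1)] subspace_add subspace_diff; simp)+
    then show ?thesis
      by (simp add: inner_commute)
  qed
  then have "x - w \<in> W\<^sup>\<bottom>"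
    by (simp add: orthogonal_comp_def orthogonal_def)
  then show thesis
    using that[of w "x - w"] w(1) by simp
qed

lemma closed_orthogonal_comp: "closed (W\<^sup>\<bottom>)"
proof -
  have "W\<^sup>\<bottom> = (\<Inter>y\<in>W. {x. inner y x = 0})"
    by (auto simp: orthogonal_comp_def orthogonal_def)
  then show ?thesis
    by (auto intro!: closed_INT closed_Collect_eq continuous_intros)
qed

lemma subspace_closure:
  fixes U :: "'a::real_normed_vector set"
  assumes "subspace U"
  shows "subspace (closure U)"
  unfolding subspace_def
proof (intro conjI ballI allI)
  show "0 \<in> closure U"
    using assms closure_subset subspace_0 by blast
next
  fix x y assume "x \<in> closure U" "y \<in> closure U"
  then obtain a b where "\<forall>n. a n \<in> U" "a \<longlonglongrightarrow> x" "\<forall>n. b n \<in> U" "b \<longlonglongrightarrow> y"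
    unfolding closure_sequential by blast
  then have "\<forall>n. a n + b n \<in> U" "(\<lambda>n. a n + b n) \<longlonglongrightarrow> x + y"
    using assms by (auto intro: subspace_add tendsto_add)
  then show "x + y \<in> closure U"
    unfolding closure_sequential by (intro exI[of _ "\<lambda>n. a n + b n"] conjI)
next
  fix c :: real and x assume "x \<in> closure U"
  then obtain a where "\<forall>n. a n \<in> U" "a \<longlonglongrightarrow> x"
    unfolding closure_sequential by blast
  then have "\<forall>n. c *\<^sub>R a n \<in> U" "(\<lambda>n. c *\<^sub>R a n) \<longlonglongrightarrow> c *\<^sub>R x"
    using assms by (auto intro: subspace_scale tendsto_scaleR)
  then show "c *\<^sub>R x \<in> closure U"
    unfolding closure_sequential by (intro exI[of _ "\<lambda>n. c *\<^sub>R a n"] conjI)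
qed

lemma double_orthogonal_comp_eq_closure:
  fixes U :: "'a::{real_inner, complete_space} set"
  assumes "subspace U"
  shows "U\<^sup>\<bottom>\<^sup>\<bottom> = closure U"
proof
  show "closure U \<subseteq> U\<^sup>\<bottom>\<^sup>\<bottom>"
    by (intro closure_minimal orthogonal_comp_subset closed_orthogonal_comp)
  show "U\<^sup>\<bottom>\<^sup>\<bottom> \<subseteq> closure U"
  proof
    fix x assume x: "x \<in> U\<^sup>\<bottom>\<^sup>\<bottom>"
    obtain w u where wu: "x = w + u" "w \<in> closure U" "u \<in> (closure U)\<^sup>\<bottom>"
      using orthogonal_decomposition[OF closed_closure subspace_closure[OF assms]] by metis
    have "u \<in> U\<^sup>\<bottom>"
      using wu(3) orthogonal_comp_anti_mono[OF closure_subset] by blast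
    then have "inner u x = 0"
      using x by (simp add: orthogonal_comp_def orthogonal_def)
    moreover have "inner u w = 0"
      using wu(2,3) by (simp add: orthogonal_comp_def orthogonal_def inner_commute[of u])
    ultimately have "u = 0"
      by (simp add: wu(1) inner_add_right)
    then show "x \<in> closure U"
      using wu by simp
  qed
qed

lemma orthogonal_comp_sum:
  assumes "0 \<in> S" "0 \<in> T"
  shows "(S + T)\<^sup>\<bottom> = S\<^sup>\<bottom> \<inter> T\<^sup>\<bottom>"
proof
  have "S \<subseteq> S + T" "T \<subseteq> S + T"
    using assms set_plus_intro[of _ S 0 T] set_plus_intro[of 0 S _ T] by auto
  then show "(S + T)\<^sup>\<bottom> \<subseteq> S\<^sup>\<bottom> \<inter> T\<^sup>\<bottom>"
    by (simp add: orthogonal_comp_anti_mono)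
  show "S\<^sup>\<bottom> \<inter> T\<^sup>\<bottom> \<subseteq> (S + T)\<^sup>\<bottom>"
    by (auto simp: orthogonal_comp_def orthogonal_def set_plus_def inner_add_left)
qed

text \<open>For \<open>\<tau>\<close> orthogonal to \<open>M\<close>, the norm squared of \<open>\<tau> + m\<close> is the sum of those of \<open>\<tau>\<close> and \<open>m\<close>,
  hence least exactly for \<open>m = 0\<close>.\<close>

lemma is_arg_min_norm_coset:
  assumes "0 \<in> M" "\<tau> \<in> M\<^sup>\<bottom>"
  shows "is_arg_min norm (\<lambda>x. x \<in> (+) \<tau> ` M) x \<longleftrightarrow> x = \<tau>"
proof -
  have pyth: "(norm (\<tau> + m))\<^sup>2 = (norm \<tau>)\<^sup>2 + (norm m)\<^sup>2" if "m \<in> M" for m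
    using that assms(2)
    by (intro norm_add_Pythagorean) (simp add: orthogonal_comp_def orthogonal_commute[of \<tau>])
  have le: "norm \<tau> \<le> norm (\<tau> + m)" if "m \<in> M" for m
    by (rule power2_le_imp_le) (simp_all add: pyth[OF that])
  have "m = 0" if "m \<in> M" "norm (\<tau> + m) \<le> norm \<tau>" for m
  proof -
    have "norm (\<tau> + m) = norm \<tau>"
      using le that by (intro antisym)
    then show ?thesis
      using pyth[OF that(1)] by simp
  qed
  moreover have "\<tau> \<in> (+) \<tau> ` M"
    using assms(1) by force
  ultimately show ?thesis
    using le by (fastforce simp: is_arg_min_linorder)
qed

section \<open>Symmetric operators\<close>

lemma orthogonal_comp_range_symmetric:
  assumes "\<And>x y. inner (T x) y = inner x (T y)"
  shows "(range T)\<^sup>\<bottom> = null_space T"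
proof -
  have "T x = 0" if "\<And>y. inner (T y) x = 0" for x
    using that[of "T x"] assms[of "T x" x] by simp
  moreover have "inner (T y) x = 0" if "T x = 0" for x y
    using that by (simp add: assms)
  ultimately show ?thesis
    unfolding orthogonal_comp_def orthogonal_def null_space_def by blast
qed

text \<open>An isotropic vector of the semidefinite form \<open>\<langle>A x, y\<rangle>\<close> lies in its radical: if
  \<open>A x \<noteq> 0\<close>, a short step from \<open>x\<close> in the direction \<open>- A x\<close> would make the form negative, since the
  first-order change \<open>- 2 s \<langle>A x, A x\<rangle>\<close> outweighs the quadratic term.\<close>

lemma selfadjoint_nonneg_kernel:
  assumes "is_selfadjoint_nonneg A" and zero: "inner (A x) x = 0"
  shows "A x = 0"
proof (rule ccontr)
  assume nz: "A x \<noteq> 0"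
  interpret A: bounded_linear A
    using assms(1) by (simp add: is_selfadjoint_nonneg_def)
  have sym: "inner (A x) y = inner x (A y)" and nonneg: "0 \<le> inner (A x) x" for x y
    using assms(1) by (auto simp: is_selfadjoint_nonneg_def)
  define y where "y = A x"
  define q where "q = inner y y"
  define c where "c = inner (A y) y"
  \<comment> \<open>At \<open>x - s y\<close> the form takes the value \<open>s\<^sup>2 c - 2 s q\<close>, which is negative once \<open>0 < s\<close> and
    \<open>s c < 2 q\<close>; the denominator \<open>c + 1\<close> achieves this also for \<open>c = 0\<close>.\<close>
  define s where "s = q / (c + 1)"
  have c: "0 \<le> c" and q: "0 < q"
    using nz by (simp_all add: c_def q_def y_def nonneg)
  have "inner x (A y) = q"
    by (simp add: sym[symmetric] y_def q_def)
  then have "0 \<le> s * (s * c) - 2 * (s * q)"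
    using nonneg[of "x - s *\<^sub>R y"] zero
    by (simp add: A.diff A.scaleR inner_diff_left inner_diff_right algebra_simps inner_commute[of "A y" x]
        flip: y_def q_def c_def)
  moreover have s: "0 < s"
    using q c by (simp add: s_def)
  ultimately have "2 * q \<le> s * c"
    by (simp add: field_simps)
  also have "s * c \<le> q"
    using q c by (simp add: s_def field_simps)
  finally show False
    using q by simp
qed

lemma orthogonal_projector_symmetric:
  assumes "is_orthogonal_projector P"
  shows "inner (P x) y = inner x (P y)"
proof -
  have lin: "linear P" and idem: "\<And>x. P (P x) = P x"
    and ran: "range P = (null_space P)\<^sup>\<bottom>"
    using assms unfolding is_orthogonal_projector_def by (auto simp: fun_eq_iff)
  have orth: "inner (y - P y) (P x) = 0" for x y
  proof -
    have "y - P y \<in> null_space P"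
      by (simp add: null_space_def linear_diff[OF lin] idem)
    moreover have "P x \<in> (null_space P)\<^sup>\<bottom>"
      using ran by auto
    ultimately show ?thesis
      by (simp add: orthogonal_comp_def orthogonal_def)
  qed
  show ?thesis
    using orth[of y x] orth[of x y]
    by (simp add: inner_diff_left inner_commute[of x "P y"] inner_commute[of y]
        inner_commute[of "P y" "P x"])
qed

section \<open>The solution sets\<close>

context
  fixes P A :: "'a::{real_inner, complete_space} \<Rightarrow> 'a"
  assumes P: "is_orthogonal_projector P"
    and A: "is_selfadjoint_nonneg A"
begin

lemma linear_P: "linear P"
  using P by (simp add: is_orthogonal_projector_def)

lemma linear_A: "linear A"
  using A by (simp add: is_selfadjoint_nonneg_def bounded_linear.linear)

lemma orthogonal_comp_sum_ranges: "(range A + range P)\<^sup>\<bottom> = null_space A \<inter> null_space P"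
proof -
  have "0 \<in> range A" "0 \<in> range P"
    by (metis linear_0 linear_A rangeI, metis linear_0 linear_P rangeI)
  moreover have "(range A)\<^sup>\<bottom> = null_space A"
    using A by (intro orthogonal_comp_range_symmetric) (simp add: is_selfadjoint_nonneg_def)
  moreover have "(range P)\<^sup>\<bottom> = null_space P"
    by (intro orthogonal_comp_range_symmetric orthogonal_projector_symmetric P)
  ultimately show ?thesis
    by (simp add: orthogonal_comp_sum)
qed

lemma closure_sum_ranges:
  "closure (range A + range P) = (null_space A \<inter> null_space P)\<^sup>\<bottom>"
proof -
  have "subspace (range A + range P)"
  proof -
    have "subspace (range A)" "subspace (range P)"
      by (intro linear_subspace_image linear_A linear_P subspace_UNIV)+
    then have "subspace {x + y | x y. x \<in> range A \<and> y \<in> range P}"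
      by (rule subspace_sums)
    also have "{x + y | x y. x \<in> range A \<and> y \<in> range P} = range A + range P"
      unfolding set_plus_def by blast
    finally show ?thesis .
  qed
  then have "closure (range A + range P) = (range A + range P)\<^sup>\<bottom>\<^sup>\<bottom>"
    by (rule double_orthogonal_comp_eq_closure[symmetric])
  then show ?thesis
    by (simp only: orthogonal_comp_sum_ranges)
qed

lemma subspace_null_spaces: "subspace (null_space A \<inter> null_space P)"
  and closed_null_spaces: "closed (null_space A \<inter> null_space P)"
  using subspace_orthogonal_comp closed_orthogonal_comp
  by (metis orthogonal_comp_sum_ranges)+

text \<open>For the difference \<open>\<delta>\<close> of two solutions, \<open>A \<delta>\<close> lies in the range of \<open>P\<close> and \<open>\<delta>\<close> in its null space,
  so \<open>\<langle>A \<delta>, \<delta>\<rangle> = \<langle>P (A \<delta>), \<delta>\<rangle> = \<langle>A \<delta>, P \<delta>\<rangle> = 0\<close>.\<close>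

lemma is_solution_iff_diff:
  assumes "is_solution P A f g \<sigma>"
  shows "is_solution P A f g \<tau> \<longleftrightarrow> \<tau> - \<sigma> \<in> null_space A \<inter> null_space P"
proof
  assume \<tau>: "is_solution P A f g \<tau>"
  then have "P (\<tau> - \<sigma>) = 0"
    using assms by (simp add: is_solution_def linear_diff[OF linear_P])
  moreover have "A \<rho> - g = P (A \<rho> - g)" if "is_solution P A f g \<rho>" for \<rho>
    using that by (simp add: is_solution_def complementary_projector_def)
  then have "A (\<tau> - \<sigma>) = P (A (\<tau> - \<sigma>))"
    using assms \<tau> linear_diff[OF linear_P, of "A \<tau> - g" "A \<sigma> - g"]
    by (simp add: linear_diff[OF linear_A])
  ultimately have "inner (A (\<tau> - \<sigma>)) (\<tau> - \<sigma>) = 0"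
    by (metis orthogonal_projector_symmetric[OF P] inner_zero_right)
  then have "A (\<tau> - \<sigma>) = 0"
    by (rule selfadjoint_nonneg_kernel[OF A])
  with \<open>P (\<tau> - \<sigma>) = 0\<close> show "\<tau> - \<sigma> \<in> null_space A \<inter> null_space P"
    by (simp add: null_space_def)
next
  assume "\<tau> - \<sigma> \<in> null_space A \<inter> null_space P"
  then have "A \<tau> = A \<sigma>" "P \<tau> = P \<sigma>"
    by (simp_all add: null_space_def linear_diff[OF linear_P] linear_diff[OF linear_A])
  then show "is_solution P A f g \<tau>"
    using assms by (simp add: is_solution_def linear_diff[OF linear_P])
qed

lemma solution_set_eq_coset:
  assumes "is_solution P A f g \<sigma>"
  shows "{\<tau>. is_solution P A f g \<tau>} = (+) \<sigma> ` (null_space A \<inter> null_space P)"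
  using is_solution_iff_diff[OF assms] by (force simp: image_iff)

lemma is_normal_solution_iff:
  assumes "is_solution P A f g \<tau>" "\<tau> \<in> closure (range A + range P)"
  shows "is_normal_solution P A f g x \<longleftrightarrow> x = \<tau>"
proof -
  have "is_solution P A f g = (\<lambda>x. x \<in> (+) \<tau> ` (null_space A \<inter> null_space P))"
    using solution_set_eq_coset[OF assms(1)] by (simp add: set_eq_iff fun_eq_iff)
  moreover have "\<tau> \<in> (null_space A \<inter> null_space P)\<^sup>\<bottom>"
    using assms(2) by (simp only: closure_sum_ranges)
  ultimately show ?thesis
    by (simp only: is_normal_solution_def is_arg_min_norm_coset[OF subspace_0[OF subspace_null_spaces]])
qed

text \<open>Removing from a solution its component in \<open>N(A) \<inter> N(P)\<close> leaves a solution.\<close>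

lemma ex_solution_in_closure:
  assumes "is_solution P A f g \<sigma>"
  obtains \<tau> where "is_solution P A f g \<tau>" "\<tau> \<in> closure (range A + range P)"
proof -
  let ?M = "null_space A \<inter> null_space P"
  obtain m \<tau> where "\<sigma> = m + \<tau>" "m \<in> ?M" "\<tau> \<in> ?M\<^sup>\<bottom>"
    using orthogonal_decomposition[OF closed_null_spaces subspace_null_spaces] by metis
  moreover from this have "\<tau> - \<sigma> \<in> ?M"
    using subspace_neg[OF subspace_null_spaces, of m] by simp
  ultimately show thesis
    using that[of \<tau>] is_solution_iff_diff[OF assms, of \<tau>] unfolding closure_sum_ranges by blast
qed

lemma solution_in_closure_unique:
  assumes "is_solution P A f g \<tau>" "\<tau> \<in> closure (range A + range P)"
    and "is_solution P A f g \<tau>'" "\<tau>' \<in> closure (range A + range P)"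
  shows "\<tau>' = \<tau>"
  using is_normal_solution_iff[OF assms(1,2)] is_normal_solution_iff[OF assms(3,4)] by blast

end

theorem lemma4p2:
  fixes P A :: "'a::{real_inner, complete_space} \<Rightarrow> 'a"
  assumes "is_orthogonal_projector P"
    and "is_selfadjoint_nonneg A"
  shows "(\<forall>f g \<sigma>. is_solution P A f g \<sigma> \<longrightarrow>
            (null_space A \<inter> null_space P = {0} \<longrightarrow> (\<exists>!\<tau>. is_solution P A f g \<tau>)) \<and>
            {\<tau>. is_solution P A f g \<tau>} = (+) \<sigma> ` (null_space A \<inter> null_space P) \<and>
            is_hyperplane ((+) \<sigma> ` (null_space A \<inter> null_space P)) \<and>
            (\<exists>!\<tau>. is_normal_solution P A f g \<tau>) \<and>
            (\<forall>\<tau>. is_normal_solution P A f g \<tau> \<longrightarrow>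
              (+) \<sigma> ` (null_space A \<inter> null_space P) \<inter> closure (range A + range P) = {\<tau>})) \<and>
         subspace (closure (range A + range P)) \<and>
         closure (range A + range P) = {\<tau>. \<exists>f g. is_normal_solution P A f g \<tau>}"
proof (intro conjI allI impI)
  fix f g \<sigma> assume \<sigma>: "is_solution P A f g \<sigma>"
  note coset = solution_set_eq_coset[OF assms \<sigma>]
  obtain \<tau>0 where \<tau>0: "is_solution P A f g \<tau>0" "\<tau>0 \<in> closure (range A + range P)"
    using ex_solution_in_closure[OF assms \<sigma>] .
  note normal = is_normal_solution_iff[OF assms \<tau>0]
  show "\<exists>!\<tau>. is_solution P A f g \<tau>" if "null_space A \<inter> null_space P = {0}"
    using \<sigma> is_solution_iff_diff[OF assms \<sigma>] that by auto
  show "{\<tau>. is_solution P A f g \<tau>} = (+) \<sigma> ` (null_space A \<inter> null_space P)"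
    by (fact coset)
  show "is_hyperplane ((+) \<sigma> ` (null_space A \<inter> null_space P))"
    unfolding is_hyperplane_def
    using subspace_null_spaces[OF assms] closed_null_spaces[OF assms] by blast
  show "\<exists>!\<tau>. is_normal_solution P A f g \<tau>"
    unfolding normal by simp
  show "(+) \<sigma> ` (null_space A \<inter> null_space P) \<inter> closure (range A + range P) = {\<tau>}"
    if "is_normal_solution P A f g \<tau>" for \<tau>
    using that solution_in_closure_unique[OF assms \<tau>0] \<tau>0 unfolding coset[symmetric] normal by blast
next
  show "subspace (closure (range A + range P))"
    by (simp add: closure_sum_ranges[OF assms] subspace_orthogonal_comp)
next
  show "closure (range A + range P) = {\<tau>. \<exists>f g. is_normal_solution P A f g \<tau>}"
  proof (intro equalityI subsetI)
    fix \<tau> assume \<tau>: "\<tau> \<in> closure (range A + range P)"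
    \<comment> \<open>Every element solves the problem whose data it generates itself.\<close>
    have "is_solution P A \<tau> (A \<tau>) \<tau>"
      by (simp add: is_solution_def complementary_projector_def linear_0[OF linear_P[OF assms]])
    then have "is_normal_solution P A \<tau> (A \<tau>) \<tau>"
      using is_normal_solution_iff[OF assms _ \<tau>] by blast
    then show "\<tau> \<in> {\<tau>. \<exists>f g. is_normal_solution P A f g \<tau>}"
      by blast
  next
    fix \<tau> assume "\<tau> \<in> {\<tau>. \<exists>f g. is_normal_solution P A f g \<tau>}"
    then obtain f g where normal: "is_normal_solution P A f g \<tau>"
      by blast
    then have "is_solution P A f g \<tau>"
      by (simp add: is_normal_solution_def is_arg_min_def)
    then obtain \<tau>0 where \<tau>0: "is_solution P A f g \<tau>0" "\<tau>0 \<in> closure (range A + range P)"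
      by (rule ex_solution_in_closure[OF assms])
    then show "\<tau> \<in> closure (range A + range P)"
      using is_normal_solution_iff[OF assms \<tau>0] normal by simp
  qed
qed

end
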